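(* Let $N,n\ge 1$ and $s\ge 1$ be integers, and let $\frac{\mathrm{d}\boldsymbol{u}}{\mathrm{d}t} = \mathsf{P}\boldsymbol{u}$, with $\boldsymbol{u}(t)\in\mathbb{R}^{nN}$, be a conservative semi-discretization with respect to the norm matrix $\mathsf{H}$. Let $$\mathsf{A}_{\mathsf{D}} = -\varepsilon\, \mathsf{H}^{-1}\tilde{\mathsf{D}}_s^{\mathrm{T}}\,\mathsf{C}\,\tilde{\mathsf{D}}_s$$ be an artificial dissipation operator as defined in the context. Then the augmented semi-discretization $$\frac{\mathrm{d}\boldsymbol{u}}{\mathrm{d}t} = \mathsf{P}\boldsymbol{u} + \mathsf{A}_{\mathsf{D}}\boldsymbol{u}$$ is conservative.
   Context: Setting: semi-discretizations in one space dimension of a system of $n$ equations ($n=1$ is the scalar case) on $N$ nodes. $\mathsf{P}\boldsymbol{u}$ denotes a (possibly nonlinear) summation-by-parts semi-discretization in which homogeneous boundary conditions are implicitly enforced. Norm matrix: $\mathsf{H}^{(1\mathrm{D})}\in\mathbb{R}^{N\times N}$ is diagonal and positive definite (a diagonal-norm quadrature), and $\mathsf{H}=\mathsf{H}^{(1\mathrm{D})}\otimes \mathsf{I}_n$, where $\mathsf{I}_n$ is the $n\times n$ identity. Undivided derivative operator: let $\tilde{\boldsymbol{x}}=[\tilde x_1,\dots,\tilde x_N]^{\mathrm{T}}$ with $0\le\tilde x_1<\dots<\tilde x_N\le N-1$ be the nodes on the reference domain $[0,N-1]$, with powers $\tilde{\boldsymbol{x}}^i$ taken entrywise. $\tilde{\mathsf{D}}_s^{(1\mathrm{D})}\in\mathbb{R}^{N\times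 N}$ is a matrix satisfying the accuracy conditions $\tilde{\mathsf{D}}_s^{(1\mathrm{D})}\tilde{\boldsymbol{x}}^i=\boldsymbol{0}$ for $i=0,\dots,s-1$ and $\tilde{\mathsf{D}}_s^{(1\mathrm{D})}\tilde{\boldsymbol{x}}^s = s!\,\boldsymbol{1}$, where $\boldsymbol{1}=[1,\dots,1]^{\mathrm{T}}\in\mathbb{R}^N$; and $\tilde{\mathsf{D}}_s=\tilde{\mathsf{D}}_s^{(1\mathrm{D})}\otimes\mathsf{I}_n$. Dissipation parameters: $\varepsilon\ge 0$ is a real number and $\mathsf{C}\in\mathbb{R}^{nN\times nN}$ is a symmetric positive semi-definite matrix (which may depend on the state $\boldsymbol{u}$). Conservation: a semi-discretization $\frac{\mathrm{d}\boldsymbol{u}}{\mathrm{d}t}=\boldsymbol{R}(\boldsymbol{u})$ is conservative with respect to $\mathsf{H}$ if, for every state $\boldsymbol{u}$, the rate of change of the discrete integral, $(\boldsymbol{1}\otimes\mathsf{I}_n)^{\mathrm{T}}\mathsf{H}\frac{\mathrm{d}\boldsymbol{u}}{\mathrm{d}t}=(\boldsymbol{1}\otimes\mathsf{I}_n)^{\mathrm{T}}\mathsf{H}\boldsymbol{R}(\boldsymbol{u})\in\mathbb{R}^n$, equals $\boldsymbol{b}(\boldsymbol{u})$, where $\boldsymbol{b}(\boldsymbol{u})$ is the prescribed net boundary flux contribution of the problem (for example $\boldsymbol{b}\equiv\boldsymbol{0}$ for a periodic domain). The same functional $\boldsymbol{b}$ is used for the original and for the augmented scheme. *)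

theory Defs
  imports Complex_Main "HOL-Library.FuncSet" "Jordan_Normal_Form.Gauss_Jordan_Elimination"
begin

text \<open>Grid functions for \<open>n\<close> equations on \<open>N\<close> nodes are vectors of dimension \<open>N * n\<close>, ordered node by
  node: the value of equation \<open>e\<close> at node \<open>j\<close> (both counted from 0) has index \<open>j * n + e\<close>.\<close>

definition kronecker :: "real mat \<Rightarrow> real mat \<Rightarrow> real mat" (infixl \<open>\<otimes>\<^sub>K\<close> 75) where
  "A \<otimes>\<^sub>K B = mat (dim_row A * dim_row B) (dim_col A * dim_col B)
     (\<lambda>(i, j). A $$ (i div dim_row B, j div dim_col B) * B $$ (i mod dim_row B, j mod dim_col B))"

definition ones_vec :: "nat \<Rightarrow> real vec" where
  "ones_vec N = vec N (\<lambda>_. 1)"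

definition symmetric_mat :: "nat \<Rightarrow> real mat \<Rightarrow> bool" where
  "symmetric_mat m A \<longleftrightarrow> A \<in> carrier_mat m m \<and> transpose_mat A = A"

definition positive_definite :: "nat \<Rightarrow> real mat \<Rightarrow> bool" where
  "positive_definite m A \<longleftrightarrow>
     symmetric_mat m A \<and> (\<forall>v\<in>carrier_vec m. v \<noteq> 0\<^sub>v m \<longrightarrow> v \<bullet> (A *\<^sub>v v) > 0)"

definition positive_semidefinite :: "nat \<Rightarrow> real mat \<Rightarrow> bool" where
  "positive_semidefinite m A \<longleftrightarrow>
     symmetric_mat m A \<and> (\<forall>v\<in>carrier_vec m. v \<bullet> (A *\<^sub>v v) \<ge> 0)"

definition diagonal_norm :: "nat \<Rightarrow> real mat \<Rightarrow> bool" where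
  "diagonal_norm N H1 \<longleftrightarrow> H1 \<in> carrier_mat N N \<and> diagonal_mat H1 \<and> positive_definite N H1"

definition reference_nodes :: "nat \<Rightarrow> real vec \<Rightarrow> bool" where
  "reference_nodes N x \<longleftrightarrow> x \<in> carrier_vec N \<and>
     (\<forall>i<N. 0 \<le> x $ i \<and> x $ i \<le> real N - 1) \<and> (\<forall>i<N. \<forall>j<N. i < j \<longrightarrow> x $ i < x $ j)"

definition undivided_derivative :: "nat \<Rightarrow> nat \<Rightarrow> real vec \<Rightarrow> real mat \<Rightarrow> bool" where
  "undivided_derivative N s x D1 \<longleftrightarrow> D1 \<in> carrier_mat N N \<and>
     (\<forall>i<s. D1 *\<^sub>v map_vec (\<lambda>t. t ^ i) x = 0\<^sub>v N) \<and>
     D1 *\<^sub>v map_vec (\<lambda>t. t ^ s) x = fact s \<cdot>\<^sub>v ones_vec N"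

text \<open>\<open>mat_inverse\<close> returns an option; it is \<open>Some\<close> of the inverse for every invertible \<open>H\<close>, in
  particular for norm matrices.\<close>

definition dissipation_mat :: "real \<Rightarrow> real mat \<Rightarrow> real mat \<Rightarrow> real mat \<Rightarrow> real mat" where
  "dissipation_mat \<epsilon> H D C = (- \<epsilon>) \<cdot>\<^sub>m (the (mat_inverse H) * transpose_mat D * C * D)"

text \<open>A semi-discretization \<open>du/dt = R(u)\<close> is represented by its right-hand side \<open>R\<close>; \<open>b\<close> is the
  prescribed net boundary flux contribution.\<close>

definition conservative ::
  "nat \<Rightarrow> nat \<Rightarrow> real mat \<Rightarrow> (real vec \<Rightarrow> real vec) \<Rightarrow> (real vec \<Rightarrow> real vec) \<Rightarrow> bool" where
  "conservative N n H b R \<longleftrightarrow>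
     (\<forall>u\<in>carrier_vec (N * n).
        transpose_mat (mat_of_cols N [ones_vec N] \<otimes>\<^sub>K 1\<^sub>m n) *\<^sub>v (H *\<^sub>v R u) = b u)"

end

theory Submission
  imports Defs "Jordan_Normal_Form.Determinant"
begin

text \<open>The dissipation term cannot change the discrete integral, because undivided differences
  annihilate constants. Write \<open>E = \<one> \<otimes> I\<close>, so that the discrete integral of \<open>v\<close> is
  \<open>E\<^sup>T H v\<close>. Applied to the dissipation term it is \<open>- \<epsilon> E\<^sup>T H H\<^sup>-\<^sup>1 D\<^sup>T C D u =
  - \<epsilon> (D E)\<^sup>T C D u\<close>, and \<open>D E = (D\<^sub>1 \<one>) \<otimes> I = 0\<close>: the accuracy condition of order 0,
  available as soon as \<open>s \<ge> 1\<close>, says \<open>D\<^sub>1 \<one> = 0\<close>.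

  Two facts carry this argument: the mixed product rule for Kronecker products
  (\<open>kronecker_mult\<close>), and that \<open>H\<close> is invertible, so that \<open>mat_inverse H\<close>
  yields a genuine inverse (\<open>mat_inverse_kronecker_one\<close>).\<close>

lemma kronecker_carrier [simp]:
  assumes "A \<in> carrier_mat m p" and "B \<in> carrier_mat k q"
  shows "A \<otimes>\<^sub>K B \<in> carrier_mat (m * k) (p * q)"
  using assms by (auto simp: kronecker_def)

text \<open>The index \<open>k < p * q\<close> runs over all pairs \<open>(k div q, k mod q)\<close>, so the sum factors.\<close>

lemma sum_div_mod_product:
  fixes f g :: "nat \<Rightarrow> 'a :: comm_semiring_0"
  shows "(\<Sum>k<p * q. f (k div q) * g (k mod q)) = (\<Sum>i<p. f i) * (\<Sum>j<q. g j)"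
proof (cases "q = 0")
  case False
  have *: "i * q + j < p * q" if "i < p" "j < q" for i j
  proof -
    have "i * q + j < Suc i * q" using that by simp
    also have "\<dots> \<le> p * q" using that by (intro mult_le_mono1) simp
    finally show ?thesis .
  qed
  have "(\<Sum>k<p * q. f (k div q) * g (k mod q)) = (\<Sum>(i, j)\<in>{..<p} \<times> {..<q}. f i * g j)"
    using False *
    by (intro sum.reindex_bij_witness[where i = "\<lambda>(i, j). i * q + j" and j = "\<lambda>k. (k div q, k mod q)"])
      (auto simp: less_mult_imp_div_less)
  then show ?thesis
    by (simp add: sum_product sum.cartesian_product)
qed simp

lemma kronecker_mult:
  assumes A: "A \<in> carrier_mat m p" and B: "B \<in> carrier_mat k q"
    and A': "A' \<in> carrier_mat p r" and B': "B' \<in> carrier_mat q t"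
  shows "(A \<otimes>\<^sub>K B) * (A' \<otimes>\<^sub>K B') = (A * A') \<otimes>\<^sub>K (B * B')" (is "?L = ?R")
proof (rule eq_matI)
  fix i j assume "i < dim_row ?R" "j < dim_col ?R"
  then have ij: "i < m * k" "j < r * t" using assms by (auto simp: kronecker_def)
  then have pos: "0 < k" "0 < t" by (auto intro: gr0I)
  have bounds: "i div k < m" "i mod k < k" "j div t < r" "j mod t < t"
    using ij pos by (auto simp: less_mult_imp_div_less)
  have "?L $$ (i, j) = (\<Sum>l<p * q. (A $$ (i div k, l div q) * B $$ (i mod k, l mod q)) *
      (A' $$ (l div q, j div t) * B' $$ (l mod q, j mod t)))"
    using assms ij by (simp add: kronecker_def scalar_prod_def atLeast0LessThan)
  also have "\<dots> = (\<Sum>l<p * q. (A $$ (i div k, l div q) * A' $$ (l div q, j div t)) *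
      (B $$ (i mod k, l mod q) * B' $$ (l mod q, j mod t)))"
    by (simp add: mult_ac)
  also have "\<dots> = (\<Sum>l<p. A $$ (i div k, l) * A' $$ (l, j div t)) *
      (\<Sum>l<q. B $$ (i mod k, l) * B' $$ (l, j mod t))"
    by (rule sum_div_mod_product)
  also have "\<dots> = ?R $$ (i, j)"
    using assms ij bounds by (simp add: kronecker_def scalar_prod_def atLeast0LessThan)
  finally show "?L $$ (i, j) = ?R $$ (i, j)" .
qed (use assms in \<open>auto simp: kronecker_def\<close>)

lemma kronecker_one: "1\<^sub>m N \<otimes>\<^sub>K 1\<^sub>m n = 1\<^sub>m (N * n)"
proof (rule eq_matI)
  fix i j assume "i < dim_row (1\<^sub>m (N * n) :: real mat)" "j < dim_col (1\<^sub>m (N * n) :: real mat)"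
  then have ij: "i < N * n" "j < N * n" by auto
  then have "0 < n" by (auto intro: gr0I)
  then have "i div n < N" "j div n < N" "i mod n < n" "j mod n < n"
    using ij by (auto simp: less_mult_imp_div_less)
  moreover have "i = j \<longleftrightarrow> i div n = j div n \<and> i mod n = j mod n"
    by (metis div_mult_mod_eq)
  ultimately show "(1\<^sub>m N \<otimes>\<^sub>K 1\<^sub>m n) $$ (i, j) = 1\<^sub>m (N * n) $$ (i, j)"
    using ij by (auto simp: kronecker_def)
qed (auto simp: kronecker_def)

lemma kronecker_zero_left: "0\<^sub>m m p \<otimes>\<^sub>K B = 0\<^sub>m (m * dim_row B) (p * dim_col B)"
  by (rule eq_matI) (auto simp: kronecker_def less_mult_imp_div_less)

lemma mat_inverse_right_inverse:
  fixes A B :: "'a :: field mat"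
  assumes A: "A \<in> carrier_mat m m" and B: "B \<in> carrier_mat m m" and AB: "A * B = 1\<^sub>m m"
  shows "the (mat_inverse A) \<in> carrier_mat m m" and "A * the (mat_inverse A) = 1\<^sub>m m"
proof -
  have "B * A = 1\<^sub>m m" by (rule mat_mult_left_right_inverse[OF A B AB])
  then have "A \<in> Units (ring_mat TYPE('a) m undefined)"
    using A B AB by (auto simp: Units_def ring_mat_simps)
  then obtain G where "mat_inverse A = Some G"
    using mat_inverse(1)[OF A, of undefined] by (cases "mat_inverse A") auto
  then show "the (mat_inverse A) \<in> carrier_mat m m" "A * the (mat_inverse A) = 1\<^sub>m m"
    using mat_inverse(2)[OF A] by auto
qed

text \<open>A kernel vector \<open>v\<close> would have \<open>v \<bullet> (A *\<^sub>v v) = 0\<close>, so the kernel is trivial.\<close>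

lemma positive_definite_right_inverse:
  assumes "positive_definite m A"
  obtains B where "B \<in> carrier_mat m m" and "A * B = 1\<^sub>m m"
proof -
  have A: "A \<in> carrier_mat m m"
    and pos: "\<And>v. v \<in> carrier_vec m \<Longrightarrow> v \<noteq> 0\<^sub>v m \<Longrightarrow> v \<bullet> (A *\<^sub>v v) > 0"
    using assms by (auto simp: positive_definite_def symmetric_mat_def)
  have "det A \<noteq> 0"
    unfolding det_0_iff_vec_prod_zero[OF A] using pos by force
  then have "A \<in> Units (ring_mat TYPE(real) m undefined)"
    by (rule det_non_zero_imp_unit[OF A])
  then show ?thesis
    by (auto simp: Units_def ring_mat_simps intro: that)
qed

text \<open>The inverse of \<open>A \<otimes> I\<close> is \<open>A\<^sup>-\<^sup>1 \<otimes> I\<close>; exhibiting it shows that \<open>mat_inverse\<close> succeeds.\<close>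

lemma mat_inverse_kronecker_one:
  assumes "positive_definite N A"
  shows "the (mat_inverse (A \<otimes>\<^sub>K 1\<^sub>m n)) \<in> carrier_mat (N * n) (N * n)"
    and "(A \<otimes>\<^sub>K 1\<^sub>m n) * the (mat_inverse (A \<otimes>\<^sub>K 1\<^sub>m n)) = 1\<^sub>m (N * n)"
proof -
  obtain B where B: "B \<in> carrier_mat N N" and AB: "A * B = 1\<^sub>m N"
    using positive_definite_right_inverse[OF assms] .
  have A: "A \<in> carrier_mat N N"
    using assms by (simp add: positive_definite_def symmetric_mat_def)
  have "(A \<otimes>\<^sub>K 1\<^sub>m n) * (B \<otimes>\<^sub>K 1\<^sub>m n) = 1\<^sub>m (N * n)"
    by (simp add: kronecker_mult[OF A one_carrier_mat B one_carrier_mat] AB kronecker_one)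
  then show "the (mat_inverse (A \<otimes>\<^sub>K 1\<^sub>m n)) \<in> carrier_mat (N * n) (N * n)"
    and "(A \<otimes>\<^sub>K 1\<^sub>m n) * the (mat_inverse (A \<otimes>\<^sub>K 1\<^sub>m n)) = 1\<^sub>m (N * n)"
    using mat_inverse_right_inverse[OF kronecker_carrier[OF A one_carrier_mat]
        kronecker_carrier[OF B one_carrier_mat]] by blast+
qed

lemma undivided_derivative_annihilates_constants:
  assumes D1: "undivided_derivative N s x D1" and x: "x \<in> carrier_vec N" and "s \<ge> 1"
  shows "(D1 \<otimes>\<^sub>K 1\<^sub>m n) * (mat_of_cols N [ones_vec N] \<otimes>\<^sub>K 1\<^sub>m n) = 0\<^sub>m (N * n) (1 * n)"
proof -
  have D1c: "D1 \<in> carrier_mat N N"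
    using D1 by (simp add: undivided_derivative_def)
  have ones: "mat_of_cols N [ones_vec N] \<in> carrier_mat N 1"
    using mat_of_cols_carrier(1)[of N "[ones_vec N]"] by simp
  \<comment> \<open>Since \<open>t ^ 0 = 1\<close> also at \<open>t = 0\<close>, the zeroth power of the nodes is the constant vector.\<close>
  have "map_vec (\<lambda>t. t ^ 0) x = ones_vec N"
    using x by (intro eq_vecI) (auto simp: ones_vec_def)
  moreover have "D1 *\<^sub>v map_vec (\<lambda>t. t ^ 0) x = 0\<^sub>v N"
  proof -
    have "\<forall>i<s. D1 *\<^sub>v map_vec (\<lambda>t. t ^ i) x = 0\<^sub>v N"
      using D1 by (simp add: undivided_derivative_def)
    from this[rule_format, of 0] show ?thesis using \<open>s \<ge> 1\<close> by linarith
  qed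
  ultimately have "D1 *\<^sub>v ones_vec N = 0\<^sub>v N" by metis
  then have "D1 * mat_of_cols N [ones_vec N] = 0\<^sub>m N 1"
    using D1c ones
    by (intro mat_col_eqI) (auto simp: ones_vec_def)
  then show ?thesis
    by (simp add: kronecker_mult[OF D1c one_carrier_mat ones one_carrier_mat] kronecker_zero_left)
qed

text \<open>In \<open>E\<^sup>T H H\<^sup>-\<^sup>1 D\<^sup>T C D u\<close> the inverse cancels, which leaves the factor
  \<open>E\<^sup>T D\<^sup>T = (D E)\<^sup>T = 0\<close>.\<close>

lemma dissipation_preserves_weighted_sums:
  assumes E: "E \<in> carrier_mat m k" and H: "H \<in> carrier_mat m m"
    and D: "D \<in> carrier_mat m m" and C: "C \<in> carrier_mat m m" and u: "u \<in> carrier_vec m"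
    and G: "the (mat_inverse H) \<in> carrier_mat m m" and HG: "H * the (mat_inverse H) = 1\<^sub>m m"
    and DE: "D * E = 0\<^sub>m m k"
  shows "transpose_mat E *\<^sub>v (H *\<^sub>v (dissipation_mat \<epsilon> H D C *\<^sub>v u)) = 0\<^sub>v k"
proof -
  let ?G = "the (mat_inverse H)"
  have ETDT: "transpose_mat E * transpose_mat D = 0\<^sub>m k m"
    using transpose_mult[OF D E] DE by simp
  define w where "w = C *\<^sub>v (D *\<^sub>v u)"
  have w: "w \<in> carrier_vec m" using C D u by (simp add: w_def)
  have "dissipation_mat \<epsilon> H D C *\<^sub>v u = (- \<epsilon>) \<cdot>\<^sub>v (?G *\<^sub>v (transpose_mat D *\<^sub>v w))"
  proof -
    have "dissipation_mat \<epsilon> H D C *\<^sub>v u = (- \<epsilon>) \<cdot>\<^sub>v ((?G * transpose_mat D * C * D) *\<^sub>v u)"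
      unfolding dissipation_mat_def using G D C u by (intro eq_vecI) auto
    also have "(?G * transpose_mat D * C * D) *\<^sub>v u = (?G * transpose_mat D) *\<^sub>v w"
      using G D C u by (simp add: w_def assoc_mult_mat_vec[of _ m m _ m])
    also have "\<dots> = ?G *\<^sub>v (transpose_mat D *\<^sub>v w)"
      using G D w by (intro assoc_mult_mat_vec) auto
    finally show ?thesis .
  qed
  then have "H *\<^sub>v (dissipation_mat \<epsilon> H D C *\<^sub>v u) = (- \<epsilon>) \<cdot>\<^sub>v (transpose_mat D *\<^sub>v w)"
  proof -
    have DTw: "transpose_mat D *\<^sub>v w \<in> carrier_vec m" using D w by simp
    then have "H *\<^sub>v (?G *\<^sub>v (transpose_mat D *\<^sub>v w)) = transpose_mat D *\<^sub>v w"
      by (metis assoc_mult_mat_vec[OF H G] HG one_mult_mat_vec)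
    then show ?thesis
      using \<open>dissipation_mat \<epsilon> H D C *\<^sub>v u = _\<close> mult_mat_vec[OF H mult_mat_vec_carrier[OF G DTw]]
      by simp
  qed
  then have "transpose_mat E *\<^sub>v (H *\<^sub>v (dissipation_mat \<epsilon> H D C *\<^sub>v u)) =
      (- \<epsilon>) \<cdot>\<^sub>v ((transpose_mat E * transpose_mat D) *\<^sub>v w)"
    using D E w by (simp add: mult_mat_vec[of _ k m] assoc_mult_mat_vec[of _ k m _ m])
  then show ?thesis
    using w by (auto simp: ETDT)
qed

theorem theorem1:
  fixes N n s :: nat
    and H1 D1 H D :: "real mat"
    and x :: "real vec"
    and \<epsilon> :: real
    and C :: "real vec \<Rightarrow> real mat"
    and P b :: "real vec \<Rightarrow> real vec"
  assumes "N \<ge> 1" and "n \<ge> 1" and "s \<ge> 1"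
    and "diagonal_norm N H1" and "H = H1 \<otimes>\<^sub>K 1\<^sub>m n"
    and "reference_nodes N x"
    and "undivided_derivative N s x D1" and "D = D1 \<otimes>\<^sub>K 1\<^sub>m n"
    and "\<epsilon> \<ge> 0"
    and "\<And>u. u \<in> carrier_vec (N * n) \<Longrightarrow> positive_semidefinite (N * n) (C u)"
    and "P \<in> carrier_vec (N * n) \<rightarrow> carrier_vec (N * n)"
    and "b \<in> carrier_vec (N * n) \<rightarrow> carrier_vec n"
    and "conservative N n H b P"
  shows "conservative N n H b (\<lambda>u. P u + dissipation_mat \<epsilon> H D (C u) *\<^sub>v u)"
proof -
  have x: "x \<in> carrier_vec N" using assms(6) by (simp add: reference_nodes_def)
  have pd: "positive_definite N H1" and H1: "H1 \<in> carrier_mat N N"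
    using assms(4) by (auto simp: diagonal_norm_def)
  have D1: "D1 \<in> carrier_mat N N" using assms(7) by (simp add: undivided_derivative_def)
  have H: "H \<in> carrier_mat (N * n) (N * n)" and D: "D \<in> carrier_mat (N * n) (N * n)"
    using H1 D1 assms(5,8) by auto
  define E where "E = mat_of_cols N [ones_vec N] \<otimes>\<^sub>K 1\<^sub>m n"
  have "mat_of_cols N [ones_vec N] \<in> carrier_mat N 1"
    using mat_of_cols_carrier(1)[of N "[ones_vec N]"] by simp
  then have E: "E \<in> carrier_mat (N * n) (1 * n)"
    unfolding E_def by (rule kronecker_carrier) simp
  have DE: "D * E = 0\<^sub>m (N * n) (1 * n)"
    unfolding E_def assms(8)
    by (rule undivided_derivative_annihilates_constants[OF assms(7) x assms(3)])
  have G: "the (mat_inverse H) \<in> carrier_mat (N * n) (N * n)"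
    and HG: "H * the (mat_inverse H) = 1\<^sub>m (N * n)"
    unfolding assms(5) by (rule mat_inverse_kronecker_one[OF pd])+
  show ?thesis
    unfolding conservative_def E_def[symmetric]
  proof
    fix u :: "real vec" assume u: "u \<in> carrier_vec (N * n)"
    define a where "a = dissipation_mat \<epsilon> H D (C u) *\<^sub>v u"
    have C: "C u \<in> carrier_mat (N * n) (N * n)"
      using assms(10)[OF u] by (simp add: positive_semidefinite_def symmetric_mat_def)
    have a: "a \<in> carrier_vec (N * n)"
      unfolding a_def dissipation_mat_def using G D C u
      by (intro mult_mat_vec_carrier smult_carrier_mat mult_carrier_mat transpose_carrier_mat[THEN iffD2])
    have P: "P u \<in> carrier_vec (N * n)" using assms(11) u by auto
    have b: "b u \<in> carrier_vec n" using assms(12) u by auto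
    have "transpose_mat E *\<^sub>v (H *\<^sub>v (P u + a)) =
        transpose_mat E *\<^sub>v (H *\<^sub>v P u) + transpose_mat E *\<^sub>v (H *\<^sub>v a)"
      using P a H E by (simp add: mult_add_distrib_mat_vec[of _ "N * n" "N * n"]
          mult_add_distrib_mat_vec[of _ n "N * n"])
    also have "transpose_mat E *\<^sub>v (H *\<^sub>v a) = 0\<^sub>v n"
      unfolding a_def using dissipation_preserves_weighted_sums[OF E H D C u G HG DE] by simp
    also have "transpose_mat E *\<^sub>v (H *\<^sub>v P u) = b u"
      using assms(13) u by (simp add: conservative_def E_def)
    finally show "transpose_mat E *\<^sub>v (H *\<^sub>v (P u + dissipation_mat \<epsilon> H D (C u) *\<^sub>v u)) = b u"
      using b by (simp add: a_def)
  qed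
qed

end
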